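(* For continuous 3-player Guts, viewed as player 1 against the coalition of players 2 and 3 (who may choose arbitrary strategies $(p_2^*,p_3^* )\in[0,1]^2$), there is no strategy, pure or mixed, guaranteeing a nonnegative return for player 1.
   Context: Continuous 3-player Guts: players 1, 2, 3 receive independent hands $p_1,p_2,p_3$ uniform on $[0,1]$. A pure strategy of player $i$ is a threshold $p_i^*\in[0,1]$: hold if $p_i\ge p_i^*$, drop if $p_i<p_i^*$. Each ante is one unit, so the pot is $3$. Let $r$ be the number of holding players. If $r=0$, the immediate return to each player is $0$ and the game is replayed with stakes factor $1$. If $r\ge1$, the stakes factor for the replay is $r-1$ (factor $0$ means the game ends) and a player's immediate return is $(r-2)+3$ if the player holds and has the highest hand among holders, $(r-2)-3$ if the player holds but does not have the highest hand, and $r-2$ if the player drops. $\alpha(p_1^*,p_2^*,p_3^* )$ is the expected immediate return to player 1, $\beta(p_1^*,p_2^*,p_3^* )$ the expected stakes factor; both are extended to mixed strategies of player 1 (probability measures on $[0,1]$) by averaging. Total return: player 1 may stop at any time by forfeiting the ante (fee $1$ times current stakes). For a sequence $S=(\mu_1,\mu_2,\dots)$ of mixed strategies of player 1 (one per round), the return guaranteed by $S$ in the $n$-truncated game is $g_n(S)=G_1$, where $G_{n+1}=-1$ and $G_k=\inf_{(q,s)\in[0,1]^2}[\alpha(\mu_k,q,s)+\beta(\mu_k,q,s)G_{k+1}]$ for $k=n,\dots,1$. $S$ guarantees a nonnegative return if $\sup_n g_n(S)\ge0$. *)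

theory Defs
  imports "HOL-Probability.Probability"
begin

text \<open>
  Players are numbered 1, 2, 3; hand vectors and threshold vectors are functions of the player.
\<close>

definition hands :: "(nat \<Rightarrow> real) measure" where
  "hands = PiM {1, 2, 3} (\<lambda>_. uniform_measure lborel {0..1})"

definition holders :: "(nat \<Rightarrow> real) \<Rightarrow> (nat \<Rightarrow> real) \<Rightarrow> nat set" where
  "holders t p = {i \<in> {1, 2, 3}. t i \<le> p i}"

text \<open>
  Two holders with equal hands both count as highest; this happens with probability 0.
\<close>

definition immediate_return :: "nat \<Rightarrow> (nat \<Rightarrow> real) \<Rightarrow> (nat \<Rightarrow> real) \<Rightarrow> real" where
  "immediate_return i t p =
    (let H = holders t p; r = real (card H) in
     if H = {} then 0
     else if i \<notin> H then r - 2
     else if (\<forall>j\<in>H. p j \<le> p i) then (r - 2) + 3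
     else (r - 2) - 3)"

definition stakes_factor :: "(nat \<Rightarrow> real) \<Rightarrow> (nat \<Rightarrow> real) \<Rightarrow> real" where
  "stakes_factor t p =
    (let H = holders t p in if H = {} then 1 else real (card H) - 1)"

definition thresholds :: "real \<Rightarrow> real \<Rightarrow> real \<Rightarrow> nat \<Rightarrow> real" where
  "thresholds x q s = (\<lambda>_. 0)(1 := x, 2 := q, 3 := s)"

definition alpha :: "real \<Rightarrow> real \<Rightarrow> real \<Rightarrow> real" where
  "alpha x q s = (\<integral>p. immediate_return 1 (thresholds x q s) p \<partial>hands)"

definition beta :: "real \<Rightarrow> real \<Rightarrow> real \<Rightarrow> real" where
  "beta x q s = (\<integral>p. stakes_factor (thresholds x q s) p \<partial>hands)"

definition unit_borel :: "real measure" where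
  "unit_borel = restrict_space borel {0..1}"

definition mixed_strategy :: "real measure \<Rightarrow> bool" where
  "mixed_strategy \<mu> \<longleftrightarrow> prob_space \<mu> \<and> sets \<mu> = sets unit_borel"

definition pure_strategy :: "real measure \<Rightarrow> bool" where
  "pure_strategy \<mu> \<longleftrightarrow> (\<exists>x\<in>{0..1}. \<mu> = return unit_borel x)"

definition mixed_alpha :: "real measure \<Rightarrow> real \<Rightarrow> real \<Rightarrow> real" where
  "mixed_alpha \<mu> q s = (\<integral>x. alpha x q s \<partial>\<mu>)"

definition mixed_beta :: "real measure \<Rightarrow> real \<Rightarrow> real \<Rightarrow> real" where
  "mixed_beta \<mu> q s = (\<integral>x. beta x q s \<partial>\<mu>)"

text \<open>
  \<open>truncated_value S n k\<close> is the return player 1 is guaranteed from round \<open>k\<close> on, per unit of the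
  stakes at round \<open>k\<close>, when forfeiting after round \<open>n\<close>; the value for \<open>k > n\<close> is the
  forfeited ante. The infimum is over a set of reals that is bounded below, since
  \<open>\<bar>alpha\<bar> \<le> 4\<close> and \<open>0 \<le> beta \<le> 2\<close>.
\<close>

function truncated_value :: "(nat \<Rightarrow> real measure) \<Rightarrow> nat \<Rightarrow> nat \<Rightarrow> real" where
  "truncated_value S n k =
    (if n < k then - 1
     else INF (q, s) \<in> {0..1} \<times> {0..1}.
       mixed_alpha (S k) q s + mixed_beta (S k) q s * truncated_value S n (Suc k))"
  by auto
termination
  by (relation "Wellfounded.measure (\<lambda>(S, n, k). Suc n - k)") auto

declare truncated_value.simps [simp del]

definition guaranteed_return :: "nat \<Rightarrow> (nat \<Rightarrow> real measure) \<Rightarrow> real" where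
  "guaranteed_return n S = truncated_value S n 1"

text \<open>
  The supremum is taken in the extended reals, so no boundedness is presupposed.
\<close>

definition guarantees_nonneg_return :: "(nat \<Rightarrow> real measure) \<Rightarrow> bool" where
  "guarantees_nonneg_return S \<longleftrightarrow> (SUP n\<in>{1..}. ereal (guaranteed_return n S)) \<ge> 0"

end

theory Submission
  imports Defs
begin

text \<open>
  The coalition can force a definite expected loss on player 1 in every round, whatever player 1
  does. It suffices to find a probability distribution over threshold pairs \<open>(q, s)\<close> of
  players 2 and 3 whose average of \<open>alpha x q s\<close> is at most some \<open>- c < 0\<close> for all thresholds
  \<open>x\<close> at once. Averaging over a mixed strategy \<open>\<mu>\<close> of player 1 then keeps the bound, so
  against each \<open>\<mu>\<close> some pair in the support of the distribution gives
  \<open>mixed_alpha \<mu> q s \<le> - c\<close>. Since stakes factors are nonnegative, a continuation worth at most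
  \<open>- c\<close> adds nothing positive, so each round is again worth at most \<open>- c\<close>; with \<open>c \<le> 1\<close> the
  forfeited ante starts a backward induction which bounds all truncated values by \<open>- c\<close>.

  The symmetric pair \<open>(b, b)\<close> with \<open>2 * b\<^sup>2 = 1\<close> holds player 1 to a return of exactly 0 and no
  less: every \<open>x \<le> b\<close> returns 0, every \<open>x > b\<close> less. A slightly smaller \<open>b\<close> makes the
  thresholds below \<open>b\<close> lose, but still returns 0 at \<open>x = b\<close> and concedes a tiny gain just above.
  The pair \<open>(0, 1)\<close>, where player 2 always holds and player 3 almost surely drops, has the
  opposite profile: it returns \<open>2 * x - 3 * x\<^sup>2\<close>, which rewards a loose player 1 but is negative for
  \<open>x > 2 / 3\<close>. With \<open>2 / 3 < b < 1 / sqrt 2\<close> each pair can thus make up for the weakness of the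
  other; \<open>b = 17 / 25\<close> and the odds \<open>1 : 13\<close> give \<open>c = 1 / 1000\<close> (\<open>coalition_mix_alpha\<close>).

  The closed forms of \<open>alpha\<close> come from conditioning on the hand \<open>y\<close> of player 1. The immediate
  return is affine in the indicators that an opponent holds and in a product of one factor per
  opponent, so independence of the opponents' hands gives the conditional mean at once
  (\<open>integral_return1\<close>), and one integration of a piecewise polynomial over \<open>y\<close> remains.
\<close>

section \<open>Bounded functions on probability spaces\<close>

lemma bounded_integrable:
  fixes f :: "'a \<Rightarrow> real"
  assumes "prob_space M" "f \<in> borel_measurable M" "\<And>x. x \<in> space M \<Longrightarrow> \<bar>f x\<bar> \<le> B"
  shows "integrable M f"
proof -
  interpret prob_space M by fact
  show ?thesis by (rule integrable_const_bound[of _ B]) (use assms in auto)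
qed

text \<open>
  A function that is not integrable has integral 0, which satisfies the bound as well. Thus the
  means of the return and of the stakes factor are bounded for all thresholds without computing them.
\<close>

lemma (in prob_space) abs_integral_le:
  fixes f :: "'a \<Rightarrow> real"
  assumes "\<And>x. x \<in> space M \<Longrightarrow> \<bar>f x\<bar> \<le> B" "0 \<le> B"
  shows "\<bar>\<integral>x. f x \<partial>M\<bar> \<le> B"
proof (cases "integrable M f")
  case True
  have "\<bar>\<integral>x. f x \<partial>M\<bar> \<le> (\<integral>x. \<bar>f x\<bar> \<partial>M)"
    by (rule integral_abs_bound)
  also have "\<dots> \<le> (\<integral>x. B \<partial>M)"
    by (rule integral_mono) (use assms True in auto)
  finally show ?thesis by (simp add: prob_space)
qed (use assms in \<open>simp add: not_integrable_integral_eq\<close>)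

section \<open>Integration against the uniform distribution of a hand\<close>

abbreviation unif :: "real measure" where
  "unif \<equiv> uniform_measure lborel {0..1}"

lemma prob_space_unif: "prob_space unif"
  by (rule prob_space_uniform_measure) auto

lemma prob_space_hands: "prob_space hands"
  unfolding hands_def by (intro prob_space_PiM prob_space_unif)

lemma integral_unif:
  fixes f :: "real \<Rightarrow> real"
  assumes [measurable]: "f \<in> borel_measurable borel"
  shows "(LINT z|unif. f z) = (LINT z|lborel. indicator {0..1} z * f z)"
proof -
  have "unif = density lborel (\<lambda>z. ennreal (indicator {0..1} z))"
    unfolding uniform_measure_def
    by (rule arg_cong[where f = "density lborel"]) (auto simp: divide_ennreal_def indicator_def)
  then show ?thesis
    by (simp add: integral_density)
qed

lemma integral_unif_holds:
  assumes "q \<in> {0..1}"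
  shows "(LINT z|unif. (if q \<le> z then 1 else 0)) = (1 - q :: real)"
proof -
  have "(LINT z|unif. (if q \<le> z then 1 else 0 :: real)) = (LINT z|lborel. indicator {q..1} z)"
    by (subst integral_unif, measurable, rule Bochner_Integration.integral_cong)
       (use assms in \<open>auto split: split_indicator\<close>)
  then show ?thesis using assms by simp
qed

text \<open>
  The indicator says that an opponent with threshold \<open>q\<close> and hand \<open>z\<close> is no obstacle to a hand
  \<open>y\<close>: that opponent drops, or holds without a higher hand. The cut-off at 1 makes the formula
  true for every real \<open>y\<close>, including the null set of hands outside the unit interval.
\<close>

lemma integral_unif_not_beating:
  assumes "q \<in> {0..1}"
  shows "(LINT z|unif. (if z < q \<or> z \<le> y then 1 else 0)) = (min 1 (max q y) :: real)"
proof -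
  let ?A = "{0..1} \<inter> ({..<q} \<union> {..y})"
  have "(LINT z|unif. (if z < q \<or> z \<le> y then 1 else 0 :: real)) = (LINT z|lborel. indicator ?A z)"
    by (subst integral_unif, measurable, rule Bochner_Integration.integral_cong)
       (auto split: split_indicator)
  also have "\<dots> = measure lborel ?A"
    by simp
  also have "?A = (if y < q then {0..<q} else {0..min 1 y})"
    using assms by auto
  also have "measure lborel \<dots> = min 1 (max q y)"
    using assms by auto
  finally show ?thesis .
qed

text \<open>
  This is the shape of the conditional mean return of player 1 given the own hand, for opponents
  with a common threshold \<open>u\<close>: constant while player 1 drops, constant while player 1 holds below
  \<open>u\<close>, then a polynomial.
\<close>

lemma integral_unif_piecewise:
  fixes f F :: "real \<Rightarrow> real"
  assumes "0 \<le> x" "x \<le> u" "u \<le> 1"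
    and [measurable]: "f \<in> borel_measurable borel"
    and "\<And>y. 0 \<le> y \<Longrightarrow> y < x \<Longrightarrow> f y = D"
    and "\<And>y. x \<le> y \<Longrightarrow> y < u \<Longrightarrow> f y = C"
    and f: "\<And>y. u \<le> y \<Longrightarrow> y \<le> 1 \<Longrightarrow> f y = g y"
    and F: "\<And>y. (F has_real_derivative g y) (at y)"
    and g: "continuous_on UNIV g"
  shows "(LINT y|unif. f y) = D * x + C * (u - x) + (F 1 - F u)"
proof -
  have "(LINT y|unif. f y) = (LINT y|lborel. (D * indicator {0..<x} y + C * indicator {x..<u} y)
      + indicator {u..1} y *\<^sub>R g y)"
    by (subst integral_unif)
       (use assms in \<open>auto simp: indicator_def intro!: Bochner_Integration.integral_cong\<close>)
  also have "\<dots> = (D * x + C * (u - x)) + (LINT y|lborel. indicator {u..1} y *\<^sub>R g y)"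
  proof (subst Bochner_Integration.integral_add)
    have "set_integrable lborel {u..1} g"
      by (intro borel_integrable_atLeastAtMost' continuous_on_subset[OF g]) auto
    then show "integrable lborel (\<lambda>y. indicator {u..1} y *\<^sub>R g y)"
      by (simp only: set_integrable_def)
  qed (use assms in auto)
  also have "(LINT y|lborel. indicator {u..1} y *\<^sub>R g y) = F 1 - F u"
    using assms by (intro integral_FTC_atLeastAtMost)
      (auto intro: continuous_on_subset[OF g] has_field_derivative_at_within
        simp flip: has_real_derivative_iff_has_vector_derivative)
  finally show ?thesis by simp
qed

section \<open>The expected immediate return of player 1\<close>

text \<open>
  The immediate return of player 1 with hand \<open>y\<close> against hands \<open>z\<close> and \<open>w\<close>, written in
  indicators. If player 1 drops, it is \<open>r - 2\<close>, where the last product corrects the value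
  to 0 when nobody holds. If player 1 holds, it is the losing value \<open>r - 5\<close>, and winning, which
  means that neither opponent stands in the way, adds 6.
\<close>

definition return1 :: "real \<Rightarrow> real \<Rightarrow> real \<Rightarrow> real \<Rightarrow> real \<Rightarrow> real \<Rightarrow> real" where
  "return1 x q s y z w =
    (if y < x
     then (if q \<le> z then 1 else 0) + (if s \<le> w then 1 else 0) - 2
          + 2 * (1 - (if q \<le> z then 1 else 0)) * (1 - (if s \<le> w then 1 else 0))
     else (if q \<le> z then 1 else 0) + (if s \<le> w then 1 else 0) - 4
          + 6 * (if z < q \<or> z \<le> y then 1 else 0) * (if w < s \<or> w \<le> y then 1 else 0))"

lemma immediate_return_1:
  "immediate_return 1 (thresholds x q s) p = return1 x q s (p 1) (p 2) (p 3)"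
proof -
  have H: "holders (thresholds x q s) p =
      (if x \<le> p 1 then {1} else {}) \<union> (if q \<le> p 2 then {2} else {}) \<union> (if s \<le> p 3 then {3} else {})"
    by (auto simp: holders_def thresholds_def)
  show ?thesis
    unfolding immediate_return_def H return1_def Let_def by auto
qed

text \<open>
  The conditional mean of \<open>return1\<close> given the hand \<open>y\<close>: each indicator is replaced by its
  probability.
\<close>

definition mean_return1 :: "real \<Rightarrow> real \<Rightarrow> real \<Rightarrow> real \<Rightarrow> real" where
  "mean_return1 x q s y =
    (if y < x then 2 * q * s - q - s
     else 6 * min 1 (max q y) * min 1 (max s y) - 2 - q - s)"

lemma return1_bound: "\<bar>return1 x q s y z w\<bar> \<le> 4"
  by (auto simp: return1_def)

text \<open>
  Stated for arbitrary measurable hands, so that it serves both on the product space of all hands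
  and after one opponent's hand has been split off.
\<close>

lemma measurable_return1:
  assumes [measurable]: "f \<in> borel_measurable M" "g \<in> borel_measurable M" "h \<in> borel_measurable M"
  shows "(\<lambda>p. return1 x q s (f p) (g p) (h p)) \<in> borel_measurable M"
  unfolding return1_def by measurable

lemma integral_return1:
  assumes "q \<in> {0..1}" "s \<in> {0..1}"
  shows "(LINT w|unif. LINT z|unif. return1 x q s y z w) = mean_return1 x q s y"
proof -
  interpret prob_space unif by (rule prob_space_unif)
  note [simp] = integral_unif_holds[OF assms(1)] integral_unif_holds[OF assms(2)]
    integral_unif_not_beating[OF assms(1)] integral_unif_not_beating[OF assms(2)] prob_space
  have int [simp]: "integrable unif (\<lambda>z. if P z then 1 else 0 :: real)"
    if [measurable]: "Measurable.pred borel P" for P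
    by (rule bounded_integrable[OF prob_space_unif, of _ 1]) auto
  show ?thesis
  proof (cases "y < x")
    case True
    then show ?thesis
      by (simp add: return1_def mean_return1_def algebra_simps)
  next
    case False
    then show ?thesis
      by (simp add: return1_def mean_return1_def algebra_simps)
  qed
qed

text \<open>
  Fubini, integrating out the opponents first: the hand of player 1 comes last because both
  indicator factors in the holding case depend on it.
\<close>

lemma alpha_eq_integral:
  assumes "q \<in> {0..1}" "s \<in> {0..1}"
  shows "alpha x q s = (LINT y|unif. mean_return1 x q s y)"
proof -
  let ?P = "\<lambda>I. PiM I (\<lambda>_::nat. unif)"
  interpret U: prob_space unif by (rule prob_space_unif)
  interpret product_prob_space "\<lambda>_::nat. unif" UNIV
    by unfold_locales
  have P: "prob_space (?P I)" for I
    by (intro prob_space_PiM prob_space_unif)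
  have component: "(\<lambda>p. p i) \<in> borel_measurable (?P I)" if "i \<in> I" for i I
    using measurable_component_singleton[OF that, of "\<lambda>_. unif"] by (simp cong: measurable_cong_sets)
  have int3: "integrable (?P (insert 2 {3, 1})) (\<lambda>p. return1 x q s (p 1) (p 2) (p 3))"
    by (rule bounded_integrable[OF P measurable_return1 return1_bound]; rule component; simp)
  have "(\<lambda>p. LINT z|unif. return1 x q s (p 1) z (p 3)) \<in> borel_measurable (?P (insert 3 {1}))"
  proof (rule U.borel_measurable_lebesgue_integral, unfold split_beta', rule measurable_return1)
    show "(\<lambda>p. fst p 1) \<in> borel_measurable (?P (insert 3 {1}) \<Otimes>\<^sub>M unif)"
      by (rule measurable_compose[OF measurable_fst component]) simp
    show "(\<lambda>p. fst p 3) \<in> borel_measurable (?P (insert 3 {1}) \<Otimes>\<^sub>M unif)"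
      by (rule measurable_compose[OF measurable_fst component]) simp
    show "(\<lambda>p. snd p) \<in> borel_measurable (?P (insert 3 {1}) \<Otimes>\<^sub>M unif)"
      by (rule measurable_compose[OF measurable_snd]) simp
  qed
  then have int2: "integrable (?P (insert 3 {1})) (\<lambda>p. LINT z|unif. return1 x q s (p 1) z (p 3))"
    by (rule bounded_integrable[OF P]) (rule U.abs_integral_le, rule return1_bound, simp)
  have "alpha x q s = (LINT p|?P (insert 2 {3, 1}). return1 x q s (p 1) (p 2) (p 3))"
    by (simp add: alpha_def hands_def immediate_return_1[unfolded One_nat_def] insert_commute)
  also have "\<dots> = (LINT p|?P (insert 3 {1}). LINT z|unif. return1 x q s (p 1) z (p 3))"
    using product_integral_insert[OF _ _ int3] by simp
  also have "\<dots> = (LINT p|?P {1}. LINT w|unif. LINT z|unif. return1 x q s (p 1) z w)"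
    using product_integral_insert[OF _ _ int2] by simp
  also have "\<dots> = (LINT p|?P {1}. mean_return1 x q s (p 1))"
    by (simp add: integral_return1[OF assms])
  also have "\<dots> = (LINT y|unif. mean_return1 x q s y)"
    by (rule product_integral_singleton) (simp add: mean_return1_def)
  finally show ?thesis .
qed

lemma alpha_split_coalition:
  assumes "x \<in> {0..1}"
  shows "alpha x 0 1 = 2 * x - 3 * x\<^sup>2"
proof -
  \<comment> \<open>Dropping always costs 1; holding on \<open>y\<close> returns \<open>6 * y - 3\<close>, a duel with player 2.\<close>
  have "(LINT y|unif. mean_return1 x 0 1 y)
      = (-1) * x + 0 * (x - x) + ((3 * 1^2 - 3 * 1) - (3 * x^2 - 3 * x))"
    by (rule integral_unif_piecewise[where g = "\<lambda>y. 6 * y - 3"])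
       (use assms in \<open>auto simp: mean_return1_def intro!: derivative_eq_intros continuous_intros\<close>)
  then show ?thesis by (simp add: alpha_eq_integral)
qed

text \<open>
  Below the opponents' common threshold \<open>b\<close> the return is linear in \<open>x\<close>, because a hand below
  \<open>b\<close> wins only if both opponents drop. The sign of its slope changes where \<open>2 * b\<^sup>2 = 1\<close>, that
  is, where both drop with probability one half.
\<close>

lemma alpha_symmetric_coalition:
  assumes x: "x \<in> {0..1}" and b: "b \<in> {0..1}"
  shows "alpha x b b =
    (if x \<le> b then 2 * (x - b) * (1 - 2 * b\<^sup>2)
     else 2 * (1 + b\<^sup>2) * x - 2 * b - 2 * x ^ 3)"
proof -
  define F where "F = (\<lambda>y::real. 2 * y ^ 3 - (2 + 2 * b) * y)"
  have F: "(F has_real_derivative 6 * y\<^sup>2 - 2 - 2 * b) (at y)" for y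
    unfolding F_def by (auto intro!: derivative_eq_intros)
  have cont: "continuous_on UNIV (\<lambda>y. 6 * y\<^sup>2 - 2 - 2 * b)"
    by (intro continuous_intros)
  have meas: "mean_return1 x b b \<in> borel_measurable borel"
    unfolding mean_return1_def by measurable
  show ?thesis
  proof (cases "x \<le> b")
    case True
    have "(LINT y|unif. mean_return1 x b b y)
        = (2 * b\<^sup>2 - 2 * b) * x + (6 * b\<^sup>2 - 2 - 2 * b) * (b - x) + (F 1 - F b)"
      by (rule integral_unif_piecewise[OF _ _ _ meas _ _ _ F cont])
         (use x b True in \<open>auto simp: mean_return1_def power2_eq_square\<close>)
    then show ?thesis
      using True by (simp add: alpha_eq_integral[OF b b] F_def algebra_simps
          power2_eq_square power3_eq_cube)
  next
    case False
    have "(LINT y|unif. mean_return1 x b b y)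
        = (2 * b\<^sup>2 - 2 * b) * x + 0 * (x - x) + (F 1 - F x)"
      by (rule integral_unif_piecewise[OF _ _ _ meas _ _ _ F cont])
         (use x b False in \<open>auto simp: mean_return1_def power2_eq_square\<close>)
    then show ?thesis
      using False by (simp add: alpha_eq_integral[OF b b] F_def algebra_simps
          power2_eq_square power3_eq_cube)
  qed
qed

section \<open>The coalition's mixture beats every threshold\<close>

text \<open>
  Let \<open>b = 17 / 25\<close>. For \<open>x \<le> b\<close> the left-hand side is a concave quadratic, and the odds are
  chosen to make its maximum negative. Beyond \<open>b\<close> it decreases: the small gain that \<open>(b, b)\<close>
  concedes just above \<open>b\<close> is outweighed by the loss against \<open>(0, 1)\<close>.
\<close>

lemma coalition_mix_alpha:
  assumes x: "x \<in> {0..1}"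
  shows "alpha x 0 1 + 13 * alpha x (17/25) (17/25) \<le> - 14 / 1000"
proof (cases "x \<le> 17/25")
  case True
  \<comment> \<open>The square is centred at the maximum of the quadratic.\<close>
  have "0 \<le> (x - 2472/3750)\<^sup>2" by simp
  then show ?thesis using True x
    by (simp add: alpha_split_coalition alpha_symmetric_coalition power2_eq_square algebra_simps)
next
  case False
  define t where "t = x - 17/25"
  have "0 \<le> t" "0 \<le> t ^ 3" "0 \<le> t\<^sup>2" using False by (auto simp: t_def)
  \<comment> \<open>Expanding at \<open>17 / 25\<close> leaves no positive coefficient, so decrease is visible termwise.\<close>
  have "alpha x 0 1 + 13 * alpha x (17/25) (17/25)
      = - 17 / 625 - 78 / 625 * t - 1401 / 25 * t\<^sup>2 - 26 * t ^ 3"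
    using False x by (simp add: alpha_split_coalition alpha_symmetric_coalition t_def
        power2_eq_square power3_eq_cube field_simps)
  then show ?thesis using \<open>0 \<le> t\<close> \<open>0 \<le> t ^ 3\<close> \<open>0 \<le> t\<^sup>2\<close> by linarith
qed

section \<open>Bounds on returns and stakes factors\<close>

lemma abs_alpha_le: "\<bar>alpha x q s\<bar> \<le> 4"
  unfolding alpha_def immediate_return_1
  by (intro prob_space.abs_integral_le[OF prob_space_hands] return1_bound) simp

lemma card_holders_le: "card (holders t p) \<le> 3"
proof -
  have "card (holders t p) \<le> card {1, 2, 3::nat}"
    by (intro card_mono) (auto simp: holders_def)
  then show ?thesis by simp
qed

lemma stakes_factor_bounds: "0 \<le> stakes_factor t p" "stakes_factor t p \<le> 2"
proof -
  have "finite (holders t p)" by (simp add: holders_def)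
  then have "1 \<le> card (holders t p)" if "holders t p \<noteq> {}"
    using that by (simp add: Suc_le_eq card_gt_0_iff)
  then show "0 \<le> stakes_factor t p" "stakes_factor t p \<le> 2"
    using card_holders_le[of t p] by (auto simp: stakes_factor_def Let_def)
qed

lemma beta_nonneg: "0 \<le> beta x q s"
  unfolding beta_def by (simp add: stakes_factor_bounds)

lemma beta_le: "beta x q s \<le> 2"
  unfolding beta_def
  using prob_space.abs_integral_le[OF prob_space_hands, of "stakes_factor (thresholds x q s)" 2]
  by (simp add: stakes_factor_bounds)

section \<open>Mixed strategies of player 1\<close>

lemma space_mixed_strategy:
  assumes "mixed_strategy \<mu>"
  shows "space \<mu> = {0..1}"
proof -
  have "sets \<mu> = sets unit_borel" using assms by (simp add: mixed_strategy_def)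
  from sets_eq_imp_space_eq[OF this] show ?thesis
    by (simp add: unit_borel_def space_restrict_space)
qed

lemma pure_strategy_imp_mixed_strategy:
  assumes "pure_strategy \<mu>"
  shows "mixed_strategy \<mu>"
proof -
  obtain x where "x \<in> {0..1}" "\<mu> = return unit_borel x"
    using assms by (auto simp: pure_strategy_def)
  then show ?thesis
    by (auto simp: mixed_strategy_def unit_borel_def space_restrict_space intro!: prob_space_return)
qed

lemma integrable_mixed_strategy:
  fixes f :: "real \<Rightarrow> real"
  assumes "mixed_strategy \<mu>" "continuous_on {0..1} f"
  shows "integrable \<mu> f"
proof -
  obtain B where B: "\<And>x. x \<in> {0..1} \<Longrightarrow> \<bar>f x\<bar> \<le> B"
    using compact_imp_bounded[OF compact_continuous_image[OF assms(2) compact_Icc]]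
    unfolding bounded_iff by fastforce
  have "f \<in> borel_measurable unit_borel"
    unfolding unit_borel_def by (rule borel_measurable_continuous_on_restrict) fact
  then have "f \<in> borel_measurable \<mu>"
    using assms(1) by (simp add: mixed_strategy_def cong: measurable_cong_sets)
  then show ?thesis
    using assms(1) B space_mixed_strategy[OF assms(1)]
    by (intro bounded_integrable[of _ _ B]) (auto simp: mixed_strategy_def)
qed

text \<open>
  Continuity in \<open>x\<close> makes \<open>alpha\<close> integrable against every mixed strategy, which is needed
  to average the bound of \<open>coalition_mix_alpha\<close>: without integrability, \<open>mixed_alpha\<close> would be
  0 by convention.
\<close>

lemma continuous_on_alpha_split_coalition: "continuous_on {0..1} (\<lambda>x. alpha x 0 1)"
proof -
  have "continuous_on {0..1} (\<lambda>x::real. 2 * x - 3 * x\<^sup>2)"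
    by (intro continuous_intros)
  then show ?thesis
    by (rule continuous_on_eq) (simp add: alpha_split_coalition)
qed

lemma continuous_on_alpha_symmetric_coalition:
  assumes b: "b \<in> {0..1}"
  shows "continuous_on {0..1} (\<lambda>x. alpha x b b)"
proof -
  have "continuous_on ({0..b} \<union> {b..1})
     (\<lambda>x. if x \<le> b then 2 * (x - b) * (1 - 2 * b\<^sup>2) else 2 * (1 + b\<^sup>2) * x - 2 * b - 2 * x ^ 3)"
  proof (rule continuous_on_cases)
    show "continuous_on {0..b} (\<lambda>x. 2 * (x - b) * (1 - 2 * b\<^sup>2))"
      by (intro continuous_intros)
    show "continuous_on {b..1} (\<lambda>x. 2 * (1 + b\<^sup>2) * x - 2 * b - 2 * x ^ 3)"
      by (intro continuous_intros)
    show "\<forall>x. x \<in> {0..b} \<and> \<not> x \<le> b \<or> x \<in> {b..1} \<and> x \<le> b \<longrightarrow>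
        2 * (x - b) * (1 - 2 * b\<^sup>2) = 2 * (1 + b\<^sup>2) * x - 2 * b - 2 * x ^ 3"
    proof (intro allI impI)
      fix x assume "x \<in> {0..b} \<and> \<not> x \<le> b \<or> x \<in> {b..1} \<and> x \<le> b"
      then have "x = b" by auto
      then show "2 * (x - b) * (1 - 2 * b\<^sup>2) = 2 * (1 + b\<^sup>2) * x - 2 * b - 2 * x ^ 3"
        by (simp add: algebra_simps power2_eq_square power3_eq_cube)
    qed
  qed auto
  moreover have "{0..b} \<union> {b..1} = {0..1}" using b by auto
  ultimately show ?thesis
    by (subst continuous_on_cong[OF refl alpha_symmetric_coalition[OF _ b]]) simp_all
qed

text \<open>
  The weighted average of the returns against the two pure replies is at most \<open>- 1 / 1000\<close>, so
  one of the two replies does at least as well as their average. Which one it is depends on \<open>\<mu>\<close>.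
\<close>

lemma coalition_beats_mixed_strategy:
  assumes \<mu>: "mixed_strategy \<mu>"
  obtains q s where "q \<in> {0..1}" "s \<in> {0..1}" "mixed_alpha \<mu> q s \<le> - 1 / 1000"
proof -
  interpret prob_space \<mu> using \<mu> by (simp add: mixed_strategy_def)
  let ?b = "17 / 25 :: real"
  have int: "integrable \<mu> (\<lambda>x. alpha x 0 1)" "integrable \<mu> (\<lambda>x. alpha x ?b ?b)"
    by (intro integrable_mixed_strategy[OF \<mu>] continuous_on_alpha_split_coalition
          continuous_on_alpha_symmetric_coalition; simp)+
  have "mixed_alpha \<mu> 0 1 + 13 * mixed_alpha \<mu> ?b ?b = (\<integral>x. alpha x 0 1 + 13 * alpha x ?b ?b \<partial>\<mu>)"
    using int by (simp add: mixed_alpha_def)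
  also have "\<dots> \<le> (\<integral>x. - 14 / 1000 \<partial>\<mu>)"
    using int coalition_mix_alpha by (intro integral_mono) (auto simp: space_mixed_strategy[OF \<mu>])
  also have "\<dots> = - 14 / 1000" by (simp add: prob_space)
  finally have "mixed_alpha \<mu> 0 1 \<le> - 1 / 1000 \<or> mixed_alpha \<mu> ?b ?b \<le> - 1 / 1000"
    by linarith
  then show ?thesis
    using that[of 0 1] that[of ?b ?b] by auto
qed

section \<open>Backward induction over the rounds\<close>

lemma mixed_beta_nonneg: "0 \<le> mixed_beta \<mu> q s"
  unfolding mixed_beta_def by (simp add: beta_nonneg)

text \<open>
  An infimum of reals is a lower bound only for a set that is bounded below; this justifies
  replacing the infimum over the coalition's replies by the value of a particular reply.
\<close>

lemma bdd_below_round_values: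
  assumes "mixed_strategy \<mu>"
  shows "bdd_below ((\<lambda>(q, s). mixed_alpha \<mu> q s + mixed_beta \<mu> q s * G) ` A)"
proof -
  interpret prob_space \<mu> using assms by (simp add: mixed_strategy_def)
  have "- 4 - 2 * \<bar>G\<bar> \<le> mixed_alpha \<mu> q s + mixed_beta \<mu> q s * G" for q s
  proof -
    have "\<bar>mixed_alpha \<mu> q s\<bar> \<le> 4"
      unfolding mixed_alpha_def by (rule abs_integral_le) (simp_all add: abs_alpha_le)
    moreover have "\<bar>mixed_beta \<mu> q s\<bar> \<le> 2"
      unfolding mixed_beta_def by (rule abs_integral_le) (simp_all add: beta_nonneg beta_le)
    then have "\<bar>mixed_beta \<mu> q s * G\<bar> \<le> 2 * \<bar>G\<bar>"
      by (simp add: abs_mult mult_right_mono)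
    ultimately show ?thesis by linarith
  qed
  then show ?thesis by (intro bdd_belowI[of _ "- 4 - 2 * \<bar>G\<bar>"]) auto
qed

text \<open>
  The coalition's good reply costs player 1 at least \<open>1 / 1000\<close> in the current round, and the
  continuation, multiplied by a nonnegative stakes factor, cannot make up for it.
\<close>

lemma truncated_value_le:
  assumes "\<And>k. 1 \<le> k \<Longrightarrow> mixed_strategy (S k)" "1 \<le> k"
  shows "truncated_value S n k \<le> - 1 / 1000"
  using assms(2)
proof (induction "Suc n - k" arbitrary: k rule: less_induct)
  case (less k)
  show ?case
  proof (cases "n < k")
    case True
    then show ?thesis by (simp add: truncated_value.simps)
  next
    case False
    let ?G = "truncated_value S n (Suc k)"
    have G: "?G \<le> - 1 / 1000" using less False by auto
    have \<mu>: "mixed_strategy (S k)" using assms(1) less.prems by auto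
    obtain q s where qs: "q \<in> {0..1}" "s \<in> {0..1}" "mixed_alpha (S k) q s \<le> - 1 / 1000"
      by (rule coalition_beats_mixed_strategy[OF \<mu>])
    have "truncated_value S n k
        = (INF (q, s) \<in> {0..1} \<times> {0..1}. mixed_alpha (S k) q s + mixed_beta (S k) q s * ?G)"
      using False by (subst truncated_value.simps) simp
    also have "\<dots> \<le> mixed_alpha (S k) q s + mixed_beta (S k) q s * ?G"
      using cINF_lower[OF bdd_below_round_values[OF \<mu>], of "(q, s)" "{0..1} \<times> {0..1}"] qs by simp
    also have "\<dots> \<le> - 1 / 1000"
      using qs(3) G mult_nonneg_nonpos[OF mixed_beta_nonneg[of "S k" q s], of ?G] by linarith
    finally show ?thesis .
  qed
qed

text \<open>
  A pure strategy is a point mass, hence mixed, so one uniform bound on the truncated values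
  settles both cases.
\<close>

theorem corollary6p9:
  shows "\<not> (\<exists>S :: nat \<Rightarrow> real measure.
    ((\<forall>k\<ge>1. pure_strategy (S k)) \<or> (\<forall>k\<ge>1. mixed_strategy (S k))) \<and>
    guarantees_nonneg_return S)"
proof clarify
  fix S :: "nat \<Rightarrow> real measure"
  assume "(\<forall>k\<ge>1. pure_strategy (S k)) \<or> (\<forall>k\<ge>1. mixed_strategy (S k))"
  then have "mixed_strategy (S k)" if "1 \<le> k" for k
    using that pure_strategy_imp_mixed_strategy by blast
  then have "guaranteed_return n S \<le> - 1 / 1000" for n
    unfolding guaranteed_return_def by (intro truncated_value_le) auto
  then have "(SUP n\<in>{1..}. ereal (guaranteed_return n S)) \<le> ereal (- 1 / 1000)"
    by (intro SUP_least) simp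
  also have "\<dots> < 0" by simp
  finally have "\<not> 0 \<le> (SUP n\<in>{1..}. ereal (guaranteed_return n S))" by simp
  moreover assume "guarantees_nonneg_return S"
  ultimately show False by (simp add: guarantees_nonneg_return_def)
qed

end
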